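(* Let $\Bbbk$ be an algebraically closed field of characteristic $0$, let $\mathfrak g=\mathfrak{sl}_4(\Bbbk)$, and let $\mathfrak f\simeq\mathfrak{sl}_2(\Bbbk)$ be the subalgebra of $\mathfrak g$ consisting of the matrices that vanish outside the lower right $2\times 2$ block and whose lower right $2\times2$ block is traceless. Let $\mathfrak m=\mathfrak f^{\perp}$ be the orthogonal complement of $\mathfrak f$ in $\mathfrak g$ with respect to the trace form $(x,y)=\mathrm{tr}(xy)$, so that $\mathfrak g=\mathfrak f\oplus\mathfrak m$ and $[\mathfrak f,\mathfrak m]\subset\mathfrak m$. Let $\mathcal Z_{(\mathfrak g,\mathfrak f)}$ be the subalgebra of $\mathcal S(\mathfrak g)$ generated by the bi-homogeneous components (with respect to $\mathfrak g=\mathfrak f\oplus\mathfrak m$) of all $H\in\mathcal S(\mathfrak g)^{\mathfrak g}$. Then $\mathcal Z_{(\mathfrak g,\mathfrak f)}$ is not Poisson commutative.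
   Context: The symmetric algebra $\mathcal S(\mathfrak g)=\Bbbk[\mathfrak g^*]$ carries the Lie--Poisson bracket $\{\cdot,\cdot\}$, the Poisson bracket determined by $\{x,y\}=[x,y]$ for $x,y\in\mathfrak g$. A subalgebra $A\subset\mathcal S(\mathfrak g)$ is Poisson commutative if $\{A,A\}=0$. $\mathcal S(\mathfrak g)^{\mathfrak g}=\{H\in\mathcal S(\mathfrak g)\mid \{H,x\}=0\ \forall x\in\mathfrak g\}$. The decomposition $\mathfrak g=\mathfrak f\oplus\mathfrak m$ gives $\mathcal S(\mathfrak g)=\bigoplus_{i,j\ge 0}\mathcal S^i(\mathfrak f)\otimes\mathcal S^j(\mathfrak m)$; the bi-homogeneous components of $H$ are the elements $H_{(i,j)}\in\mathcal S^i(\mathfrak f)\otimes\mathcal S^j(\mathfrak m)$ with $H=\sum_{i,j}H_{(i,j)}$. *)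

theory Defs
  imports
    "HOL-Analysis.Determinants"
    "HOL-Library.Poly_Mapping"
    "HOL-Computational_Algebra.Polynomial"
begin

section \<open>Matrix Lie algebras\<close>

definition lie_bracket :: "'a::comm_ring_1 ^ 'n ^ 'n \<Rightarrow> 'a ^ 'n ^ 'n \<Rightarrow> 'a ^ 'n ^ 'n" where
  "lie_bracket A B = A ** B - B ** A"

definition matrix_unit :: "'n \<Rightarrow> 'n \<Rightarrow> 'a::comm_ring_1 ^ 'n ^ 'n" where
  "matrix_unit i j = (\<chi> k l. if k = i \<and> l = j then 1 else 0)"

definition sl :: "('a::comm_ring_1 ^ 'n ^ 'n) set" where
  "sl = {A. trace A = 0}"

text \<open>
  Rows and columns of a \<open>4 \<times> 4\<close> matrix are numbered \<open>1, 2, 3, 4\<close>, as in \<open>UNIV_4\<close> and \<open>sum_4\<close>;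
  in the index type \<open>4\<close> the numeral \<open>4\<close> equals \<open>0\<close>.
\<close>

definition lower_right_sl2 :: "('a::comm_ring_1 ^ 4 ^ 4) set" where
  "lower_right_sl2 = {A \<in> sl. (\<forall>i j. i \<notin> {3, 4} \<or> j \<notin> {3, 4} \<longrightarrow> A $ i $ j = 0) \<and>
                              A $ 3 $ 3 + A $ 4 $ 4 = 0}"

definition trace_orthogonal ::
    "('a::comm_ring_1 ^ 'n ^ 'n) set \<Rightarrow> ('a ^ 'n ^ 'n) set \<Rightarrow> ('a ^ 'n ^ 'n) set" where
  "trace_orthogonal g f = {A \<in> g. \<forall>B\<in>f. trace (A ** B) = 0}"

section \<open>Symmetric algebras\<close>

text \<open>
  The symmetric algebra of \<open>gl\<^sub>n\<close> is the polynomial ring in variables \<open>x\<^bsub>ij\<^esub>\<close>, one for each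
  matrix unit. For a subspace \<open>g\<close> of \<open>gl\<^sub>n\<close> the canonical map from the symmetric algebra of \<open>g\<close>
  to that of \<open>gl\<^sub>n\<close> is injective (extend a basis), so the symmetric algebra of \<open>g\<close> is the
  subalgebra generated by \<open>g\<close>. This avoids choosing a basis of \<open>g\<close>.
\<close>

type_synonym ('a, 'n) gl_poly = "(('n \<times> 'n) \<Rightarrow>\<^sub>0 nat) \<Rightarrow>\<^sub>0 'a"

definition scal :: "'a::field \<Rightarrow> ('a, 'n) gl_poly \<Rightarrow> ('a, 'n) gl_poly" where
  "scal c p = Poly_Mapping.single 0 c * p"

global_interpretation gl_poly: vector_space "scal :: 'a::field \<Rightarrow> ('a, 'n) gl_poly \<Rightarrow> _"
  defines gl_poly_span = gl_poly.span
  by standard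
    (simp_all add: scal_def algebra_simps single_add mult_single flip: mult.assoc)

definition var :: "'n \<Rightarrow> 'n \<Rightarrow> ('a::field, 'n) gl_poly" where
  "var i j = Poly_Mapping.single (Poly_Mapping.single (i, j) 1) 1"

definition lin :: "'a::field ^ 'n ^ 'n \<Rightarrow> ('a, 'n::finite) gl_poly" where
  "lin A = (\<Sum>i\<in>UNIV. \<Sum>j\<in>UNIV. scal (A $ i $ j) (var i j))"

inductive_set subalgebra_gen :: "('a::field, 'n) gl_poly set \<Rightarrow> ('a, 'n) gl_poly set"
  for X :: "('a, 'n) gl_poly set" where
  gen: "p \<in> X \<Longrightarrow> p \<in> subalgebra_gen X"
| one: "1 \<in> subalgebra_gen X"
| scal: "p \<in> subalgebra_gen X \<Longrightarrow> scal c p \<in> subalgebra_gen X"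
| add: "p \<in> subalgebra_gen X \<Longrightarrow> q \<in> subalgebra_gen X \<Longrightarrow> p + q \<in> subalgebra_gen X"
| mult: "p \<in> subalgebra_gen X \<Longrightarrow> q \<in> subalgebra_gen X \<Longrightarrow> p * q \<in> subalgebra_gen X"

definition sym_alg :: "('a::field ^ 'n ^ 'n) set \<Rightarrow> ('a, 'n::finite) gl_poly set" where
  "sym_alg g = subalgebra_gen (lin ` g)"

definition sym_pow :: "('a::field ^ 'n ^ 'n) set \<Rightarrow> nat \<Rightarrow> ('a, 'n::finite) gl_poly set" where
  "sym_pow V i = gl_poly_span {\<Prod>k<i. lin (x k) |x. \<forall>k<i. x k \<in> V}"

text \<open>
  The image of \<open>S\<^sup>i(V) \<otimes> S\<^sup>j(W)\<close> under multiplication.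
\<close>

definition bihom ::
    "('a::field ^ 'n ^ 'n) set \<Rightarrow> ('a ^ 'n ^ 'n) set \<Rightarrow> nat \<Rightarrow> nat \<Rightarrow> ('a, 'n::finite) gl_poly set" where
  "bihom V W i j = gl_poly_span {p * q |p q. p \<in> sym_pow V i \<and> q \<in> sym_pow W j}"

text \<open>
  When \<open>V\<close> and \<open>W\<close> are complementary subspaces of \<open>g\<close>, every element of the symmetric algebra
  of \<open>g\<close> has exactly one such family \<open>c\<close>.
\<close>

definition bihom_components ::
    "('a::field ^ 'n ^ 'n) set \<Rightarrow> ('a ^ 'n ^ 'n) set \<Rightarrow> ('a, 'n::finite) gl_poly \<Rightarrow>
     (nat \<times> nat \<Rightarrow> ('a, 'n) gl_poly) \<Rightarrow> bool" where
  "bihom_components V W H c \<longleftrightarrow>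
     (\<forall>i j. c (i, j) \<in> bihom V W i j) \<and>
     finite {ij. c ij \<noteq> 0} \<and> H = (\<Sum>ij | c ij \<noteq> 0. c ij)"

section \<open>The Lie--Poisson bracket\<close>

text \<open>
  If \<open>lookup m v = 0\<close>, then \<open>m - single v 1\<close> is truncated to \<open>m\<close>, but the coefficient is 0.
\<close>

definition pdiff :: "'n \<times> 'n \<Rightarrow> ('a::field, 'n) gl_poly \<Rightarrow> ('a, 'n) gl_poly" where
  "pdiff v p = (\<Sum>m\<in>Poly_Mapping.keys p.
     Poly_Mapping.single (m - Poly_Mapping.single v 1)
       (of_nat (Poly_Mapping.lookup m v) * Poly_Mapping.lookup p m))"

text \<open>
  The Lie--Poisson bracket of \<open>gl\<^sub>n\<close> in coordinates. Lemmas \<open>poisson_lin\<close>, \<open>poisson_skew\<close>,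
  \<open>poisson_add_left\<close>, \<open>poisson_scal_left\<close> and \<open>poisson_mult_left\<close> below say that it is the
  skew-symmetric biderivation extending the commutator, and \<open>poisson_sym_alg\<close> says that it
  restricts to the symmetric algebra of every Lie subalgebra.
\<close>

definition poisson ::
    "('a::field, 'n::finite) gl_poly \<Rightarrow> ('a, 'n) gl_poly \<Rightarrow> ('a, 'n) gl_poly" where
  "poisson F G = (\<Sum>(i, j)\<in>UNIV. \<Sum>(k, l)\<in>UNIV.
     pdiff (i, j) F * pdiff (k, l) G * lin (lie_bracket (matrix_unit i j) (matrix_unit k l)))"

definition poisson_commutative :: "('a::field, 'n::finite) gl_poly set \<Rightarrow> bool" where
  "poisson_commutative A \<longleftrightarrow> (\<forall>F\<in>A. \<forall>G\<in>A. poisson F G = 0)"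

definition sym_invariants :: "('a::field ^ 'n ^ 'n) set \<Rightarrow> ('a, 'n::finite) gl_poly set" where
  "sym_invariants g = {H \<in> sym_alg g. \<forall>x\<in>g. poisson H (lin x) = 0}"

definition Z_alg ::
    "('a::field ^ 'n ^ 'n) set \<Rightarrow> ('a ^ 'n ^ 'n) set \<Rightarrow> ('a ^ 'n ^ 'n) set \<Rightarrow>
     ('a, 'n::finite) gl_poly set" where
  "Z_alg g f m = subalgebra_gen
     {c (i, j) |H c i j. H \<in> sym_invariants g \<and> bihom_components f m H c}"

subsection \<open>Characteristic properties of the bracket\<close>

lemma poly_expand:
  fixes p :: "'b \<Rightarrow>\<^sub>0 'c::comm_monoid_add"
  assumes "finite S" "Poly_Mapping.keys p \<subseteq> S"
  shows "p = (\<Sum>m\<in>S. Poly_Mapping.single m (Poly_Mapping.lookup p m))"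
proof (rule poly_mapping_eqI)
  fix k
  have "Poly_Mapping.lookup (\<Sum>m\<in>S. Poly_Mapping.single m (Poly_Mapping.lookup p m)) k
      = (\<Sum>m\<in>S. if m = k then Poly_Mapping.lookup p k else 0)"
    by (auto simp: lookup_sum lookup_single when_def intro!: sum.cong)
  also have "\<dots> = Poly_Mapping.lookup p k"
    using assms by (auto simp: sum.delta in_keys_iff)
  finally show "Poly_Mapping.lookup p k = Poly_Mapping.lookup (\<Sum>m\<in>S. Poly_Mapping.single m (Poly_Mapping.lookup p m)) k" by simp
qed

lemma poly_add_induct [case_names zero single add]:
  fixes p :: "'b \<Rightarrow>\<^sub>0 'c::comm_monoid_add"
  assumes "P 0" "\<And>m c. P (Poly_Mapping.single m c)" "\<And>p q. P p \<Longrightarrow> P q \<Longrightarrow> P (p + q)"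
  shows "P p"
proof -
  have "P (\<Sum>m\<in>S. Poly_Mapping.single m (Poly_Mapping.lookup p m))" if "finite S" for S
    using that by (induction S) (auto intro: assms)
  from this[of "Poly_Mapping.keys p"] poly_expand[of "Poly_Mapping.keys p" p] show ?thesis by simp
qed

lemma pdiff_superset:
  assumes "finite S" "Poly_Mapping.keys p \<subseteq> S"
  shows "pdiff v p = (\<Sum>m\<in>S.
     Poly_Mapping.single (m - Poly_Mapping.single v 1) (of_nat (Poly_Mapping.lookup m v) * Poly_Mapping.lookup p m))"
  unfolding pdiff_def
  by (rule sum.mono_neutral_left) (use assms in \<open>auto simp: in_keys_iff\<close>)

lemma pdiff_zero [simp]: "pdiff v 0 = 0"
  by (simp add: pdiff_def)

lemma pdiff_single:
  "pdiff v (Poly_Mapping.single m c) =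
   Poly_Mapping.single (m - Poly_Mapping.single v 1) (of_nat (Poly_Mapping.lookup m v) * c)"
  by (subst pdiff_superset[of "{m}"]) auto

lemma pdiff_add: "pdiff v (p + q) = pdiff v p + pdiff v q"
proof -
  let ?S = "Poly_Mapping.keys p \<union> Poly_Mapping.keys q"
  have "Poly_Mapping.keys (p + q) \<subseteq> ?S" by (rule keys_add)
  then show ?thesis
    by (simp add: pdiff_superset[of ?S] lookup_add distrib_left single_add sum.distrib)
qed

lemma pdiff_sum: "pdiff v (sum h S) = (\<Sum>x\<in>S. pdiff v (h x))"
  by (induction S rule: infinite_finite_induct) (simp_all add: pdiff_add)

lemma pdiff_mult_single:
  "pdiff v (Poly_Mapping.single m c * Poly_Mapping.single m' c') =
   pdiff v (Poly_Mapping.single m c) * Poly_Mapping.single m' c' +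
   Poly_Mapping.single m c * pdiff v (Poly_Mapping.single m' c')"
proof -
  let ?e = "Poly_Mapping.single v (1::nat)"
  have sub: "a + b - ?e = (a - ?e) + b" if "Poly_Mapping.lookup a v \<noteq> 0" for a b
    using that by (intro poly_mapping_eqI)
      (auto simp: lookup_add lookup_minus lookup_single when_def)
  have 1: "Poly_Mapping.single (m + m' - ?e) (of_nat (Poly_Mapping.lookup m v) * (c * c')) =
           Poly_Mapping.single (m - ?e + m') (of_nat (Poly_Mapping.lookup m v) * (c * c'))"
    by (cases "Poly_Mapping.lookup m v = 0") (simp_all add: sub del: One_nat_def)
  have 2: "Poly_Mapping.single (m + m' - ?e) (of_nat (Poly_Mapping.lookup m' v) * (c * c')) =
           Poly_Mapping.single (m + (m' - ?e)) (of_nat (Poly_Mapping.lookup m' v) * (c * c'))"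
    by (cases "Poly_Mapping.lookup m' v = 0") (use sub[of m' m] in \<open>simp_all add: add.commute del: One_nat_def\<close>)
  have "pdiff v (Poly_Mapping.single m c * Poly_Mapping.single m' c') =
      Poly_Mapping.single (m + m' - ?e) (of_nat (Poly_Mapping.lookup m v) * (c * c')) +
      Poly_Mapping.single (m + m' - ?e) (of_nat (Poly_Mapping.lookup m' v) * (c * c'))"
    by (simp add: mult_single pdiff_single lookup_add distrib_right flip: single_add)
  then show ?thesis
    unfolding 1 2 by (simp add: mult_single pdiff_single mult_ac add_ac)
qed

lemma pdiff_mult: "pdiff v (p * q) = pdiff v p * q + p * pdiff v q"
proof (induction p rule: poly_add_induct)
  case (single m c)
  show ?case
    by (induction q rule: poly_add_induct)
      (simp_all add: pdiff_mult_single pdiff_add algebra_simps)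
qed (simp_all add: pdiff_add algebra_simps)

lemma pdiff_scal: "pdiff v (scal c p) = scal c (pdiff v p)"
  by (simp add: scal_def pdiff_mult pdiff_single)

lemma pdiff_var: "pdiff (i, j) (var k l) = (if i = k \<and> j = l then 1 else 0)"
  by (auto simp: var_def pdiff_single lookup_single when_def)

lemma pdiff_lin: "pdiff (i, j) (lin A) = Poly_Mapping.single 0 (A $ i $ j)"
proof -
  have "pdiff (i, j) (lin A) =
      (\<Sum>k\<in>UNIV. \<Sum>l\<in>UNIV. if k = i then (if l = j then scal (A $ i $ j) 1 else 0) else 0)"
    by (auto simp: lin_def pdiff_sum pdiff_scal pdiff_var intro!: sum.cong)
  also have "\<dots> = (\<Sum>k\<in>UNIV. if k = i then scal (A $ i $ j) 1 else 0)"
    by (intro sum.cong) auto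
  also have "\<dots> = Poly_Mapping.single 0 (A $ i $ j)"
    by (simp add: scal_def)
  finally show ?thesis .
qed

lemma lin_add: "lin (A + B) = lin A + lin B"
  by (simp add: lin_def gl_poly.scale_left_distrib sum.distrib)

lemma lin_scale: "lin (\<chi> i j. c * A $ i $ j) = scal c (lin A)"
  by (simp add: lin_def gl_poly.scale_sum_right)

lemma lin_zero [simp]: "lin 0 = 0"
  by (simp add: lin_def)

lemma lin_uminus: "lin (- A) = - lin A"
  using lin_add[of A "- A"] by (simp add: minus_unique)

lemma lin_sum: "lin (sum h S) = (\<Sum>x\<in>S. lin (h x))"
  by (induction S rule: infinite_finite_induct) (simp_all add: lin_add)

lemma poisson_add_left: "poisson (p + q) r = poisson p r + poisson q r"
  by (simp add: poisson_def pdiff_add split_def algebra_simps sum.distrib)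

lemma poisson_scal_left: "poisson (scal c p) r = scal c (poisson p r)"
  by (simp add: poisson_def pdiff_scal split_def gl_poly.scale_sum_right)
    (simp add: scal_def mult.assoc)

lemma poisson_mult_left: "poisson (p * q) r = poisson p r * q + p * poisson q r"
  by (simp add: poisson_def pdiff_mult split_def algebra_simps sum.distrib
      sum_distrib_left sum_distrib_right)

lemma lie_bracket_skew: "lie_bracket A B = - lie_bracket B A"
  by (simp add: lie_bracket_def)

lemma poisson_skew: "poisson F G = - poisson G F"
proof -
  have "poisson F G = (\<Sum>(k, l)\<in>UNIV. \<Sum>(i, j)\<in>UNIV.
     pdiff (i, j) F * pdiff (k, l) G * lin (lie_bracket (matrix_unit i j) (matrix_unit k l)))"
    unfolding poisson_def split_def by (rule sum.swap)
  also have "\<dots> = (\<Sum>(k, l)\<in>UNIV. \<Sum>(i, j)\<in>UNIV.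
     - (pdiff (k, l) G * pdiff (i, j) F * lin (lie_bracket (matrix_unit k l) (matrix_unit i j))))"
    unfolding split_def
    by (intro sum.cong refl, subst lie_bracket_skew) (simp add: lin_uminus mult_ac)
  also have "\<dots> = - poisson G F"
    by (simp add: poisson_def split_def sum_negf)
  finally show ?thesis .
qed

lemma poisson_lin:
  fixes A B :: "'a::field ^ 'n ^ 'n"
  shows "poisson (lin A) (lin B) = lin (lie_bracket A B)"
proof -
  have unit: "lie_bracket (matrix_unit i j) (matrix_unit k l) $ a $ b =
      (if l = b then if j = k then if i = a then 1 else 0 else 0 else 0) -
      (if k = a then if l = i then if j = b then 1 else 0 else 0 else 0 :: 'a)" for i j k l a b :: 'n
  proof -
    have "(matrix_unit i j ** matrix_unit k l) $ a $ b =
        (\<Sum>c\<in>UNIV. if c = j then (if l = b then if j = k then if i = a then 1 else 0 else 0 else 0) else 0 :: 'a)"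
      for i j k l a b :: 'n
      unfolding matrix_matrix_mult_def matrix_unit_def vec_lambda_beta
      by (intro sum.cong) auto
    then show ?thesis by (auto simp: lie_bracket_def)
  qed
  have if_sum: "(\<Sum>x\<in>S. if P then h x else 0) = (if P then \<Sum>x\<in>S. h x else 0)"
    for P and h :: "'n \<Rightarrow> 'a" and S by simp
  have entry: "lie_bracket A B $ a $ b = (\<Sum>(i, j)\<in>UNIV. \<Sum>(k, l)\<in>UNIV.
      A $ i $ j * B $ k $ l * lie_bracket (matrix_unit i j) (matrix_unit k l) $ a $ b)" for a b
  proof -
    have "(\<Sum>(i, j)\<in>UNIV. \<Sum>(k, l)\<in>UNIV.
        A $ i $ j * B $ k $ l * lie_bracket (matrix_unit i j) (matrix_unit k l) $ a $ b) =
      (\<Sum>i\<in>UNIV. \<Sum>j\<in>UNIV. \<Sum>k\<in>UNIV. \<Sum>l\<in>UNIV.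
        (if l = b then if j = k then if i = a then A $ a $ j * B $ j $ b else 0 else 0 else 0) -
        (if k = a then if l = i then if j = b then B $ a $ i * A $ i $ b else 0 else 0 else 0))"
      unfolding UNIV_Times_UNIV[symmetric] sum.cartesian_product[symmetric] unit
      by (intro sum.cong refl) auto
    also have "\<dots> = (\<Sum>i\<in>UNIV. \<Sum>j\<in>UNIV. if i = a then A $ a $ j * B $ j $ b else 0) -
        (\<Sum>i\<in>UNIV. \<Sum>j\<in>UNIV. if j = b then B $ a $ i * A $ i $ b else 0)"
      by (simp add: sum_subtractf if_sum sum.delta)
    also have "\<dots> = lie_bracket A B $ a $ b"
      by (simp add: if_sum sum.delta lie_bracket_def matrix_matrix_mult_def)
    finally show ?thesis by simp
  qed
  have "lie_bracket A B = (\<Sum>(i, j)\<in>UNIV. \<Sum>(k, l)\<in>UNIV.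
      (\<chi> a b. (A $ i $ j * B $ k $ l) * lie_bracket (matrix_unit i j) (matrix_unit k l) $ a $ b))"
    by (simp add: vec_eq_iff entry split_def)
  then have "lin (lie_bracket A B) = (\<Sum>(i, j)\<in>UNIV. \<Sum>(k, l)\<in>UNIV.
      scal (A $ i $ j * B $ k $ l) (lin (lie_bracket (matrix_unit i j) (matrix_unit k l))))"
    by (simp add: lin_sum lin_scale split_def)
  then show ?thesis
    by (simp add: poisson_def pdiff_lin split_def scal_def mult_single)
qed

lemma poisson_sym_alg:
  assumes "\<And>A B. A \<in> g \<Longrightarrow> B \<in> g \<Longrightarrow> lie_bracket A B \<in> g"
    and "F \<in> sym_alg g" and "G \<in> sym_alg g"
  shows "poisson F G \<in> sym_alg g"
proof -
  have one: "poisson 1 r = 0" for r :: "('a, 'b) gl_poly"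
    using poisson_mult_left[of 1 1 r] by simp
  have uminus: "- p \<in> sym_alg g" if "p \<in> sym_alg g" for p
    using subalgebra_gen.scal[OF that[unfolded sym_alg_def], of "-1"]
    by (simp add: sym_alg_def gl_poly.scale_minus_left)
  have zero: "0 \<in> sym_alg g"
    using subalgebra_gen.scal[OF subalgebra_gen.one, of 0] by (simp add: sym_alg_def)
  note intros = subalgebra_gen.intros(3-)[of _ "lin ` g", folded sym_alg_def]
  have lin: "poisson F (lin B) \<in> sym_alg g" if "B \<in> g" "F \<in> sym_alg g" for B F
    using that(2) unfolding sym_alg_def
  proof (induction F rule: subalgebra_gen.induct)
    case (gen p)
    then show ?case using assms(1) that(1)
      by (auto simp: poisson_lin intro: subalgebra_gen.gen)
  qed (auto simp: one poisson_scal_left poisson_add_left poisson_mult_left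
      zero[unfolded sym_alg_def] intro!: subalgebra_gen.intros(3-))
  have "poisson G F \<in> sym_alg g"
    using assms(3) unfolding sym_alg_def
  proof (induction G rule: subalgebra_gen.induct)
    case (gen p)
    then obtain B where "B \<in> g" "p = lin B" by auto
    then show ?case
      using uminus[OF lin[OF _ assms(2)]] poisson_skew[of p F] by (simp add: sym_alg_def)
  qed (auto simp: one poisson_scal_left poisson_add_left poisson_mult_left
      zero[unfolded sym_alg_def] intro!: subalgebra_gen.intros(3-)
      assms(2)[unfolded sym_alg_def])
  then show ?thesis using uminus poisson_skew[of F G] by simp
qed

end

(* Let M be the generic traceless matrix, split as M = P + Q along f and m. The traces of powers of M
   are invariants, and the components of bidegree (1,2) and (1,3) of tr M^3 and tr M^4 are
   3 tr(P Q^2) and 4 tr(P Q^3). Every other bracket of components of tr M^2, tr M^3 and tr M^4 vanishes or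
   reduces to this pair. The value of the bracket of F and G at a point depends only on their gradients
   dF, dG there and is that of the linear function [dF, dG], so one well-chosen point shows
   that the pair does not commute. *)
theory Submission
  imports Defs
begin

section \<open>Evaluation\<close>

definition monom_eval :: "('n::finite \<times> 'n \<Rightarrow> 'a::field) \<Rightarrow> ('n \<times> 'n \<Rightarrow>\<^sub>0 nat) \<Rightarrow> 'a" where
  "monom_eval \<xi> m = (\<Prod>v\<in>UNIV. \<xi> v ^ Poly_Mapping.lookup m v)"

definition poly_eval :: "('n::finite \<times> 'n \<Rightarrow> 'a::field) \<Rightarrow> ('a, 'n) gl_poly \<Rightarrow> 'a" where
  "poly_eval \<xi> p = (\<Sum>m\<in>Poly_Mapping.keys p. Poly_Mapping.lookup p m * monom_eval \<xi> m)"

lemma poly_eval_superset: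
  assumes "finite S" "Poly_Mapping.keys p \<subseteq> S"
  shows "poly_eval \<xi> p = (\<Sum>m\<in>S. Poly_Mapping.lookup p m * monom_eval \<xi> m)"
  unfolding poly_eval_def
  by (rule sum.mono_neutral_left) (use assms in \<open>auto simp: in_keys_iff\<close>)

lemma poly_eval_single: "poly_eval \<xi> (Poly_Mapping.single m c) = c * monom_eval \<xi> m"
  by (subst poly_eval_superset[of "{m}"]) auto

lemma poly_eval_add: "poly_eval \<xi> (p + q) = poly_eval \<xi> p + poly_eval \<xi> q"
proof -
  let ?S = "Poly_Mapping.keys p \<union> Poly_Mapping.keys q"
  have "Poly_Mapping.keys (p + q) \<subseteq> ?S" by (rule keys_add)
  then show ?thesis
    by (simp add: poly_eval_superset[of ?S] lookup_add distrib_right sum.distrib)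
qed

lemma poly_eval_zero [simp]: "poly_eval \<xi> 0 = 0"
  by (simp add: poly_eval_def)

lemma poly_eval_sum: "poly_eval \<xi> (sum h S) = (\<Sum>x\<in>S. poly_eval \<xi> (h x))"
  by (induction S rule: infinite_finite_induct) (simp_all add: poly_eval_add)

lemma monom_eval_add: "monom_eval \<xi> (m + m') = monom_eval \<xi> m * monom_eval \<xi> m'"
  by (simp add: monom_eval_def lookup_add power_add prod.distrib)

lemma poly_eval_mult: "poly_eval \<xi> (p * q) = poly_eval \<xi> p * poly_eval \<xi> q"
proof (induction p rule: poly_add_induct)
  case (single m c)
  show ?case
    by (induction q rule: poly_add_induct)
      (simp_all add: mult_single poly_eval_single monom_eval_add poly_eval_add algebra_simps)
qed (simp_all add: poly_eval_add algebra_simps)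

lemma poly_eval_const: "poly_eval \<xi> (Poly_Mapping.single 0 c) = c"
  by (simp add: poly_eval_single monom_eval_def)

lemma poly_eval_scal: "poly_eval \<xi> (scal c p) = c * poly_eval \<xi> p"
  by (simp add: scal_def poly_eval_mult poly_eval_const)

lemma poly_eval_var: "poly_eval \<xi> (var i j) = \<xi> (i, j)"
proof -
  have "\<xi> v ^ Poly_Mapping.lookup (Poly_Mapping.single (i, j) (1::nat)) v
      = (if v = (i, j) then \<xi> (i, j) else 1)" for v
    by (auto simp: lookup_single when_def)
  then show ?thesis
    by (simp add: var_def poly_eval_single monom_eval_def del: One_nat_def)
qed

lemma poly_eval_lin: "poly_eval \<xi> (lin A) = (\<Sum>i\<in>UNIV. \<Sum>j\<in>UNIV. A $ i $ j * \<xi> (i, j))"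
  by (simp add: lin_def poly_eval_sum poly_eval_scal poly_eval_var)

section \<open>Gradients, and the value of the Poisson bracket at a point\<close>

definition gradient :: "('n::finite \<times> 'n \<Rightarrow> 'a::field) \<Rightarrow> ('a, 'n) gl_poly \<Rightarrow> 'a ^ 'n ^ 'n" where
  "gradient \<xi> F = (\<chi> i j. poly_eval \<xi> (pdiff (i, j) F))"


lemma gradient_lin: "gradient \<xi> (lin A) = A"
  by (simp add: gradient_def pdiff_lin poly_eval_const vec_eq_iff)

text \<open>The bracket involves \<open>F\<close> and \<open>G\<close> only through first
  derivatives, so at \<open>\<xi>\<close> each may be replaced by the linear form with the same
  gradient. The gradient is itself a matrix in gl_n, and brackets of linear forms are
  commutators.\<close>

lemma poly_eval_poisson:
  "poly_eval \<xi> (poisson F G) = poly_eval \<xi> (lin (lie_bracket (gradient \<xi> F) (gradient \<xi> G)))"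
proof -
  have *: "poly_eval \<xi> (poisson F G) = (\<Sum>(i, j)\<in>UNIV. \<Sum>(k, l)\<in>UNIV.
      gradient \<xi> F $ i $ j * gradient \<xi> G $ k $ l *
      poly_eval \<xi> (lin (lie_bracket (matrix_unit i j) (matrix_unit k l))))" for F G
    by (simp add: poisson_def poly_eval_sum poly_eval_mult split_def gradient_def)
  show ?thesis
    \<comment> \<open>The right side is read backwards through \<open>poisson_lin\<close> as a
      bracket of two linear forms; \<open>*\<close> then expands both sides into the same
      sum.\<close>
    by (simp only: * [of F G] * [of "lin _" "lin _"] gradient_lin flip: poisson_lin[of "gradient \<xi> F"])
qed

section \<open>Matrices with entries in the symmetric algebra\<close>

lemma matrix_diff_ldistrib: "A ** (B - C) = A ** B - A ** (C :: 'a::comm_ring_1 ^ 'n ^ 'm)"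
  by (simp add: matrix_matrix_mult_def vec_eq_iff right_diff_distrib sum_subtractf)

lemma matrix_diff_rdistrib: "(B - C) ** A = B ** A - C ** (A :: 'a::comm_ring_1 ^ 'n ^ 'm)"
  by (simp add: matrix_matrix_mult_def vec_eq_iff left_diff_distrib sum_subtractf)

lemma matrix_add_rdistrib: "(B + C) ** A = B ** A + C ** (A :: 'a::comm_ring_1 ^ 'n ^ 'm)"
  by (simp add: matrix_matrix_mult_def vec_eq_iff distrib_right sum.distrib)

lemma matrix_zero_mult: "0 ** A = (0 :: 'a::comm_ring_1 ^ 'n ^ 'm)" "A ** 0 = (0 :: 'a ^ 'n ^ 'm)"
  by (simp_all add: matrix_matrix_mult_def vec_eq_iff)

lemma matrix_sum_ldistrib: "A ** (\<Sum>i\<in>S. h i) = (\<Sum>i\<in>S. A ** (h i :: 'a::comm_ring_1 ^ 'n ^ 'm))"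
  by (induction S rule: infinite_finite_induct)
    (simp_all add: matrix_zero_mult matrix_add_ldistrib)

lemma trace_sum: "trace (\<Sum>i\<in>S. h i) = (\<Sum>i\<in>S. trace (h i :: 'a::comm_ring_1 ^ 'n ^ 'n))"
  unfolding trace_def sum_component by (rule sum.swap)

text \<open>Transposing the matrix units makes the generic matrix the tautological function on the
  dual space, identified with matrices by the trace form.\<close>

definition generic_matrix ::
    "('a::field ^ 'n ^ 'n \<Rightarrow> 'a ^ 'n ^ 'n) \<Rightarrow> ('a, 'n::finite) gl_poly ^ 'n ^ 'n" where
  "generic_matrix p = (\<chi> k l. lin (p (matrix_unit l k)))"

section \<open>Powers of a sum of two noncommuting matrices\<close>

primrec mat_pow :: "'b::comm_ring_1 ^ 'n ^ 'n \<Rightarrow> nat \<Rightarrow> 'b ^ 'n ^ 'n" where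
  "mat_pow A 0 = mat 1"
| "mat_pow A (Suc n) = A ** mat_pow A n"

text \<open>The coefficient of \<open>s\<^sup>i t\<^sup>j\<close> in \<open>(s A + t B)\<^sup>i\<^sup>+\<^sup>j\<close>.\<close>

fun word_sum :: "'b::comm_ring_1 ^ 'n ^ 'n \<Rightarrow> 'b ^ 'n ^ 'n \<Rightarrow> nat \<Rightarrow> nat \<Rightarrow> 'b ^ 'n ^ 'n" where
  "word_sum A B 0 0 = mat 1"
| "word_sum A B (Suc i) 0 = A ** word_sum A B i 0"
| "word_sum A B 0 (Suc j) = B ** word_sum A B 0 j"
| "word_sum A B (Suc i) (Suc j) = A ** word_sum A B i (Suc j) + B ** word_sum A B (Suc i) j"

text \<open>Sort the words of length \<open>Suc n\<close> by their first letter; deleting it leaves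
  an arbitrary word of length \<open>n\<close>.\<close>

lemma word_sum_total_degree:
  "(\<Sum>i\<le>Suc n. word_sum A B i (Suc n - i)) =
   A ** (\<Sum>i\<le>n. word_sum A B i (n - i)) + B ** (\<Sum>i\<le>n. word_sum A B i (n - i))"
  (is "_ = A ** ?s + B ** ?s")
proof -
  \<comment> \<open>\<open>u i\<close> collects the words with \<open>i\<close> letters
    \<open>A\<close> that begin with \<open>A\<close>, and \<open>v i\<close> those that begin with
    \<open>B\<close>. The zeros at \<open>i = 0\<close> and \<open>i = Suc n\<close> are forced: no
    such word exists there, whereas truncated subtraction would produce a spurious term.\<close>
  define u where "u i = (if i = 0 then 0 else A ** word_sum A B (i - 1) (Suc n - i))" for i
  define v where "v i = (if i = Suc n then 0 else B ** word_sum A B i (n - i))" for i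
  have "word_sum A B i (Suc n - i) = u i + v i" if "i \<le> Suc n" for i
  proof (cases i)
    case 0
    then show ?thesis by (simp add: u_def v_def)
  next
    case (Suc k)
    show ?thesis
    proof (cases "i = Suc n")
      case False
      with that have "Suc k \<le> n" by (simp add: Suc)
      then have "n - k = Suc (n - i)" by (simp add: Suc)
      then show ?thesis using Suc False by (simp add: u_def v_def)
    qed (simp add: u_def v_def Suc)
  qed
  then have "(\<Sum>i\<le>Suc n. word_sum A B i (Suc n - i)) = (\<Sum>i\<le>Suc n. u i) + (\<Sum>i\<le>Suc n. v i)"
    by (simp add: sum.distrib del: sum.atMost_Suc)
  also have "(\<Sum>i\<le>Suc n. u i) = A ** ?s"
    by (subst sum.atMost_Suc_shift) (simp add: u_def matrix_sum_ldistrib)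
  also have "(\<Sum>i\<le>Suc n. v i) = B ** ?s"
    by (simp add: v_def matrix_sum_ldistrib)
  finally show ?thesis .
qed

lemma mat_pow_add: "mat_pow (A + B) n = (\<Sum>i\<le>n. word_sum A B i (n - i))"
proof (induction n)
  case (Suc n)
  then show ?case
    by (simp only: mat_pow.simps word_sum_total_degree matrix_add_rdistrib)
qed simp

subsection \<open>Invariants\<close>

lemma poisson_one_left [simp]: "poisson 1 r = 0"
  using poisson_mult_left[of 1 1 r] by simp

lemma poisson_zero_left [simp]: "poisson 0 r = 0"
  using poisson_add_left[of 0 0 r] by simp

lemma poisson_sum_left: "poisson (sum h S) r = (\<Sum>x\<in>S. poisson (h x) r)"
  by (induction S rule: infinite_finite_induct) (simp_all add: poisson_add_left)

definition poisson_mat ::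
    "('a::field, 'n::finite) gl_poly ^ 'n ^ 'n \<Rightarrow> ('a, 'n) gl_poly \<Rightarrow> ('a, 'n) gl_poly ^ 'n ^ 'n" where
  "poisson_mat M r = (\<chi> i j. poisson (M $ i $ j) r)"

lemma poisson_mat_mult:
  "poisson_mat (A ** B) r = poisson_mat A r ** B + A ** poisson_mat B r"
  by (simp add: poisson_mat_def matrix_matrix_mult_def vec_eq_iff poisson_sum_left
      poisson_mult_left sum.distrib)

lemma poisson_mat_one: "poisson_mat (mat 1) r = 0"
  by (simp add: poisson_mat_def mat_def vec_eq_iff)

lemma poisson_trace: "poisson (trace A) r = trace (poisson_mat A r)"
  by (simp add: poisson_mat_def trace_def poisson_sum_left)

text \<open>Bracketing with \<open>r\<close> and commuting with \<open>X\<close> both obey the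
  Leibniz rule for matrix products, so their agreement on \<open>M\<close> passes to all powers of
  \<open>M\<close>.\<close>

lemma poisson_mat_pow:
  assumes "poisson_mat M r = X ** M - M ** X"
  shows "poisson_mat (mat_pow M n) r = X ** mat_pow M n - mat_pow M n ** X"
proof (induction n)
  case (Suc n)
  then show ?case
    by (simp add: poisson_mat_mult assms matrix_diff_ldistrib matrix_diff_rdistrib
        matrix_mul_assoc)
qed (simp add: poisson_mat_one)

text \<open>Commutators of matrices over the commutative polynomial ring have trace zero.\<close>

lemma poisson_trace_mat_pow:
  assumes "poisson_mat M r = X ** M - M ** X"
  shows "poisson (trace (mat_pow M n)) r = 0"
  by (simp add: poisson_trace poisson_mat_pow[OF assms] trace_sub trace_mul_sym[of X])

section \<open>Projection onto sl_n and equivariance of the generic matrix\<close>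

definition trace_free :: "'a::field ^ 'n ^ 'n \<Rightarrow> 'a ^ 'n ^ 'n" where
  "trace_free A = A - mat (trace A / of_nat CARD('n))"

lemma trace_free_in_sl: "trace_free (A :: 'a::field_char_0 ^ 'n ^ 'n) \<in> sl"
  by (simp add: trace_free_def sl_def trace_def mat_def sum_subtractf)

lemma matrix_unit_mult_entry:
  "(matrix_unit i j ** A) $ a $ b = (if a = i then A $ j $ b else 0)"
  "(A ** matrix_unit i j) $ a $ b = (if b = j then A $ a $ i else 0)"
proof -
  have "(matrix_unit i j ** A) $ a $ b = (\<Sum>k\<in>UNIV. if k = j then if a = i then A $ j $ b else 0 else 0)"
    unfolding matrix_matrix_mult_def matrix_unit_def vec_lambda_beta by (intro sum.cong) auto
  then show "(matrix_unit i j ** A) $ a $ b = (if a = i then A $ j $ b else 0)" by simp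
  have "(A ** matrix_unit i j) $ a $ b = (\<Sum>k\<in>UNIV. if k = i then if b = j then A $ a $ i else 0 else 0)"
    unfolding matrix_matrix_mult_def matrix_unit_def vec_lambda_beta by (intro sum.cong) auto
  then show "(A ** matrix_unit i j) $ a $ b = (if b = j then A $ a $ i else 0)" by simp
qed

lemma mat_mult_entry:
  "(mat c ** A) $ a $ b = c * A $ a $ b" "(A ** mat c) $ a $ b = A $ a $ b * c"
proof -
  have "(mat c ** A) $ a $ b = (\<Sum>k\<in>UNIV. if k = a then c * A $ a $ b else 0)"
    unfolding matrix_matrix_mult_def mat_def vec_lambda_beta by (intro sum.cong) auto
  then show "(mat c ** A) $ a $ b = c * A $ a $ b" by simp
  have "(A ** mat c) $ a $ b = (\<Sum>k\<in>UNIV. if k = b then A $ a $ b * c else 0)"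
    unfolding matrix_matrix_mult_def mat_def vec_lambda_beta by (intro sum.cong) auto
  then show "(A ** mat c) $ a $ b = A $ a $ b * c" by simp
qed

lemma mat_mult_commute: "mat c ** A = A ** mat (c :: 'b::comm_ring_1)"
  by (simp add: vec_eq_iff mat_mult_entry mult.commute)

lemma lin_matrix_unit: "lin (matrix_unit i j) = var i j"
proof -
  have "lin (matrix_unit i j) = (\<Sum>k\<in>UNIV. \<Sum>l\<in>UNIV. if k = i then if l = j then var i j else 0 else 0)"
    unfolding lin_def matrix_unit_def by (intro sum.cong) (auto simp: scal_def)
  also have "\<dots> = (\<Sum>k\<in>UNIV. if k = i then var i j else 0)"
    by (intro sum.cong) auto
  finally show ?thesis by simp
qed

lemma lin_matrix_unit_mult:
  "lin (matrix_unit i j ** A) = (\<Sum>b\<in>UNIV. scal (A $ j $ b) (var i b))"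
  "lin (A ** matrix_unit i j) = (\<Sum>a\<in>UNIV. scal (A $ a $ i) (var a j))"
proof -
  have "lin (matrix_unit i j ** A) = (\<Sum>a\<in>UNIV. if a = i then \<Sum>b\<in>UNIV. scal (A $ j $ b) (var i b) else 0)"
    unfolding lin_def matrix_unit_mult_entry by (intro sum.cong) auto
  then show "lin (matrix_unit i j ** A) = (\<Sum>b\<in>UNIV. scal (A $ j $ b) (var i b))" by simp
  have "lin (A ** matrix_unit i j) = (\<Sum>a\<in>UNIV. \<Sum>b\<in>UNIV. if b = j then scal (A $ a $ i) (var a j) else 0)"
    unfolding lin_def matrix_unit_mult_entry by (intro sum.cong) auto
  then show "lin (A ** matrix_unit i j) = (\<Sum>a\<in>UNIV. scal (A $ a $ i) (var a j))" by simp
qed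

lemma lin_diff: "lin (A - B) = lin A - lin B"
  using lin_add[of A "- B"] by (simp add: lin_uminus)

text \<open>This is the infinitesimal equivariance of the generic matrix: the Hamiltonian action of
  \<open>x\<close> on its entries is a commutator with \<open>x\<close>, viewed in \<open>X\<close>
  as a matrix of constants. It supplies the hypothesis of
  \<open>poisson_trace_mat_pow\<close>.\<close>

lemma poisson_generic_matrix:
  fixes x :: "'a::field_char_0 ^ 'n ^ 'n"
  defines "X \<equiv> \<chi> i j. Poly_Mapping.single 0 (x $ i $ j)"
  shows "poisson_mat (generic_matrix trace_free) (lin x) =
    X ** generic_matrix trace_free - generic_matrix trace_free ** X"
proof -
  define t :: "('a, 'n) gl_poly" where "t = lin (mat (1 / of_nat CARD('n)))"
  define N :: "('a, 'n) gl_poly ^ 'n ^ 'n" where "N = generic_matrix id"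
  have tr: "trace (matrix_unit l k :: 'a ^ 'n ^ 'n) = (if l = k then 1 else 0)" for l k
  proof -
    have "trace (matrix_unit l k :: 'a ^ 'n ^ 'n) = (\<Sum>i\<in>UNIV. if i = l then if l = k then 1 else 0 else 0)"
      unfolding trace_def matrix_unit_def vec_lambda_beta by (intro sum.cong) auto
    then show ?thesis by simp
  qed
  \<comment> \<open>Only diagonal matrix units have nonzero trace, so removing traces changes the
    full generic matrix \<open>N\<close> by a scalar matrix, which commutes with
    \<open>X\<close>.\<close>
  have M: "generic_matrix trace_free = N - mat t"
    by (auto simp: generic_matrix_def N_def t_def vec_eq_iff trace_free_def lin_diff tr mat_def[of "lin _"])
  have "poisson (generic_matrix trace_free $ k $ l) (lin x) = (X ** N - N ** X) $ k $ l" for k l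
  proof -
    have "poisson (generic_matrix trace_free $ k $ l) (lin x)
        = lin (lie_bracket (trace_free (matrix_unit l k)) x)"
      by (simp add: generic_matrix_def poisson_lin)
    \<comment> \<open>The scalar part of \<open>trace_free\<close> commutes with \<open>x\<close>
      and drops out.\<close>
    also have "lie_bracket (trace_free (matrix_unit l k)) x = matrix_unit l k ** x - x ** matrix_unit l k"
      unfolding lie_bracket_def trace_free_def matrix_diff_ldistrib matrix_diff_rdistrib
        mat_mult_commute by simp
    also have "lin \<dots> = (X ** N - N ** X) $ k $ l"
      unfolding lin_diff lin_matrix_unit_mult
      by (simp add: matrix_matrix_mult_def X_def N_def generic_matrix_def lin_matrix_unit
          scal_def mult.commute)
    finally show ?thesis .
  qed
  then show ?thesis
    by (simp add: M matrix_diff_ldistrib matrix_diff_rdistrib mat_mult_commute)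
      (simp add: poisson_mat_def vec_eq_iff M)
qed

subsection \<open>Bihomogeneous components\<close>

lemma sym_pow_lin_mult:
  assumes "x \<in> V" "p \<in> sym_pow V i"
  shows "lin x * p \<in> sym_pow V (Suc i)"
  using assms(2) unfolding sym_pow_def
proof (induction rule: gl_poly.span_induct_alt)
  case base
  then show ?case by (simp add: gl_poly.span_zero)
next
  case (step c p q)
  then obtain y where y: "p = (\<Prod>k<i. lin (y k))" "\<forall>k<i. y k \<in> V" by auto
  have "lin x * p = (\<Prod>k<Suc i. lin ((y(i := x)) k))"
    by (simp add: y mult.commute)
  moreover have "\<forall>k<Suc i. (y(i := x)) k \<in> V" using y(2) assms(1) by auto
  ultimately have "lin x * p \<in> gl_poly_span {\<Prod>k<Suc i. lin (x k) |x. \<forall>k<Suc i. x k \<in> V}"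
    by (intro gl_poly.span_base) blast
  moreover have "lin x * (scal c p + q) = scal c (lin x * p) + lin x * q"
    by (simp add: scal_def algebra_simps)
  ultimately show ?case
    using step(2) by (simp add: gl_poly.span_add gl_poly.span_scale)
qed

lemma bihom_lin_mult_left:
  assumes "x \<in> V" "p \<in> bihom V W i j"
  shows "lin x * p \<in> bihom V W (Suc i) j"
  using assms(2) unfolding bihom_def
proof (induction rule: gl_poly.span_induct_alt)
  case base
  then show ?case by (simp add: gl_poly.span_zero)
next
  case (step c p q)
  then obtain r s where rs: "p = r * s" "r \<in> sym_pow V i" "s \<in> sym_pow W j" by auto
  have "lin x * (scal c p + q) = scal c ((lin x * r) * s) + lin x * q"
    by (simp add: scal_def algebra_simps rs)
  moreover have "(lin x * r) * s \<in> gl_poly_span {p * q |p q. p \<in> sym_pow V (Suc i) \<and> q \<in> sym_pow W j}"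
    using sym_pow_lin_mult[OF assms(1) rs(2)] rs(3) by (intro gl_poly.span_base) blast
  ultimately show ?case
    using step(2) by (simp add: gl_poly.span_add gl_poly.span_scale)
qed

text \<open>Exchanging the two factors lets multiplication by elements of \<open>W\<close> be
  deduced from multiplication by elements of \<open>V\<close>.\<close>

lemma bihom_commute: "bihom V W i j = bihom W V j i"
proof -
  have "{p * q |p q. p \<in> sym_pow V i \<and> q \<in> sym_pow W j} = {p * q |p q. p \<in> sym_pow W j \<and> q \<in> sym_pow V i}"
    by (intro Collect_cong) (metis mult.commute)
  then show ?thesis by (simp add: bihom_def)
qed

lemma bihom_lin_mult_right:
  "x \<in> W \<Longrightarrow> p \<in> bihom V W i j \<Longrightarrow> lin x * p \<in> bihom V W i (Suc j)"
  using bihom_lin_mult_left[of x W p V j i] by (simp add: bihom_commute[of V W])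

lemma one_in_bihom: "1 \<in> bihom V W 0 0"
proof -
  have "1 \<in> sym_pow U 0" for U :: "('b::field ^ 'c::finite ^ 'c) set"
    unfolding sym_pow_def by (intro gl_poly.span_base) simp
  then have "1 * 1 \<in> {p * q |p q. p \<in> sym_pow V 0 \<and> q \<in> sym_pow W 0}" by blast
  then show ?thesis
    unfolding bihom_def by (intro gl_poly.span_base) simp
qed

lemma bihom_zero: "0 \<in> bihom V W i j"
  and bihom_add: "p \<in> bihom V W i j \<Longrightarrow> q \<in> bihom V W i j \<Longrightarrow> p + q \<in> bihom V W i j"
  and bihom_sum: "(\<And>x. x \<in> S \<Longrightarrow> h x \<in> bihom V W i j) \<Longrightarrow> sum h S \<in> bihom V W i j"
  by (simp_all add: bihom_def gl_poly.span_zero gl_poly.span_add gl_poly.span_sum)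

lemma generic_matrix_mult_in_bihom:
  assumes "\<And>k l. M $ k $ l \<in> bihom V W i j"
  shows "(\<And>A. p A \<in> V) \<Longrightarrow> (generic_matrix p ** M) $ k $ l \<in> bihom V W (Suc i) j"
    and "(\<And>A. p A \<in> W) \<Longrightarrow> (generic_matrix p ** M) $ k $ l \<in> bihom V W i (Suc j)"
  using assms
  by (auto simp: matrix_matrix_mult_def generic_matrix_def
      intro!: bihom_sum bihom_lin_mult_left bihom_lin_mult_right)

lemma word_sum_in_bihom:
  assumes "\<And>A. p A \<in> V" "\<And>A. q A \<in> W"
  shows "word_sum (generic_matrix p) (generic_matrix q) i j $ k $ l \<in> bihom V W i j"
proof (induction "generic_matrix p" "generic_matrix q" i j arbitrary: k l rule: word_sum.induct)
  case 1
  then show ?case by (simp add: mat_def one_in_bihom bihom_zero)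
next
  case (2 i)
  then show ?case using assms by (simp add: generic_matrix_mult_in_bihom)
next
  case (3 j)
  then show ?case using assms by (simp add: generic_matrix_mult_in_bihom)
next
  case (4 i j)
  then show ?case using assms by (simp add: generic_matrix_mult_in_bihom bihom_add)
qed

lemma generic_matrix_add: "generic_matrix (\<lambda>A. p A + q A) = generic_matrix p + generic_matrix q"
  by (simp add: generic_matrix_def vec_eq_iff lin_add)

text \<open>The power expands into words in the two generic matrices, and the numbers of letters of
  each kind are the two degrees.\<close>

lemma bihom_components_trace_mat_pow:
  assumes "\<And>A. p A \<in> V" "\<And>A. q A \<in> W"
  shows "bihom_components V W (trace (mat_pow (generic_matrix (\<lambda>A. p A + q A)) n))
    (\<lambda>(i, j). if i + j = n then trace (word_sum (generic_matrix p) (generic_matrix q) i j) else 0)"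
    (is "bihom_components V W ?H ?c")
proof -
  have "?c (i, j) \<in> bihom V W i j" for i j
    using assms by (auto simp: trace_def intro!: bihom_zero bihom_sum word_sum_in_bihom)
  moreover have fin: "finite ((\<lambda>i. (i, n - i)) ` {..n})" by simp
  have sub: "{ij. ?c ij \<noteq> 0} \<subseteq> (\<lambda>i. (i, n - i)) ` {..n}"
    by (auto split: if_splits simp: image_iff)
  moreover have "?H = (\<Sum>ij | ?c ij \<noteq> 0. ?c ij)"
  proof -
    \<comment> \<open>Some components with \<open>i + j = n\<close> may vanish, so the sum over the
      support is first enlarged to the whole antidiagonal.\<close>
    have "(\<Sum>ij | ?c ij \<noteq> 0. ?c ij) = (\<Sum>ij \<in> (\<lambda>i. (i, n - i)) ` {..n}. ?c ij)"
      using sub by (intro sum.mono_neutral_left) auto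
    also have "\<dots> = (\<Sum>i\<le>n. ?c (i, n - i))"
      by (subst sum.reindex) (auto simp: inj_on_def)
    also have "\<dots> = ?H"
      by (simp add: generic_matrix_add mat_pow_add trace_sum)
    finally show ?thesis ..
  qed
  ultimately show ?thesis
    unfolding bihom_components_def using finite_subset[OF sub fin] by blast
qed

section \<open>Invariance of the traces of powers, and membership of their components in Z\<close>

lemma sym_alg_zero: "0 \<in> sym_alg g"
  using subalgebra_gen.scal[OF subalgebra_gen.one, of 0] by (simp add: sym_alg_def)

lemma sym_alg_sum: "(\<And>x. x \<in> S \<Longrightarrow> h x \<in> sym_alg g) \<Longrightarrow> sum h S \<in> sym_alg g"
  by (induction S rule: infinite_finite_induct)
    (auto simp: sym_alg_zero, simp add: sym_alg_def subalgebra_gen.add)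

lemma mat_pow_in_sym_alg:
  assumes "\<And>A. p A \<in> g"
  shows "mat_pow (generic_matrix p) n $ k $ l \<in> sym_alg g"
proof (induction n arbitrary: k)
  case 0
  then show ?case
    using sym_alg_zero[of g] by (auto simp: mat_def sym_alg_def subalgebra_gen.one)
next
  case (Suc n)
  have "lin (p A) \<in> sym_alg g" for A
    unfolding sym_alg_def using assms by (intro subalgebra_gen.gen) blast
  then have "lin (p A) * mat_pow (generic_matrix p) n $ k $ l \<in> sym_alg g" for A k
    using Suc unfolding sym_alg_def by (intro subalgebra_gen.mult) auto
  then show ?case
    by (auto simp: matrix_matrix_mult_def generic_matrix_def intro!: sym_alg_sum)
qed

lemma trace_mat_pow_invariant:
  "trace (mat_pow (generic_matrix trace_free) n) \<in>
     sym_invariants (sl :: ('a::field_char_0 ^ 'n ^ 'n) set)"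
proof -
  have "trace (mat_pow (generic_matrix trace_free) n) \<in> sym_alg (sl :: ('a ^ 'n ^ 'n) set)"
    unfolding trace_def by (intro sym_alg_sum mat_pow_in_sym_alg trace_free_in_sl)
  then show ?thesis
    by (simp add: sym_invariants_def poisson_trace_mat_pow[OF poisson_generic_matrix])
qed

text \<open>The trace of the power of exponent \<open>i + j\<close> is an invariant whose component
  of bidegree \<open>(i, j)\<close> is this trace, hence one of the generators.\<close>

lemma trace_word_sum_in_Z_alg:
  fixes p q :: "'a::field_char_0 ^ 'n ^ 'n \<Rightarrow> 'a ^ 'n ^ 'n"
  assumes "\<And>A. p A \<in> V" "\<And>A. q A \<in> W" "\<And>A. p A + q A = trace_free A"
  shows "trace (word_sum (generic_matrix p) (generic_matrix q) i j) \<in> Z_alg sl V W"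
proof -
  let ?c = "\<lambda>(i', j'). if i' + j' = i + j
    then trace (word_sum (generic_matrix p) (generic_matrix q) i' j') else 0"
  have "bihom_components V W (trace (mat_pow (generic_matrix trace_free) (i + j))) ?c"
    using bihom_components_trace_mat_pow[of p V q W "i + j"] assms by simp
  then have "?c (i, j) \<in> Z_alg sl V W"
    using trace_mat_pow_invariant[of "i + j"]
    unfolding Z_alg_def by (intro subalgebra_gen.gen) blast
  then show ?thesis by simp
qed

subsection \<open>Gradients\<close>

definition eval_mat ::
    "('n::finite \<times> 'n \<Rightarrow> 'a::field) \<Rightarrow> ('a, 'n) gl_poly ^ 'n ^ 'n \<Rightarrow> 'a ^ 'n ^ 'n" where
  "eval_mat \<xi> M = (\<chi> k l. poly_eval \<xi> (M $ k $ l))"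

definition deriv_mat ::
    "('n::finite \<times> 'n \<Rightarrow> 'a::field) \<Rightarrow> 'n \<times> 'n \<Rightarrow> ('a, 'n) gl_poly ^ 'n ^ 'n \<Rightarrow> 'a ^ 'n ^ 'n" where
  "deriv_mat \<xi> v M = (\<chi> k l. poly_eval \<xi> (pdiff v (M $ k $ l)))"

lemma eval_mat_mult: "eval_mat \<xi> (A ** B) = eval_mat \<xi> A ** eval_mat \<xi> B"
  by (simp add: eval_mat_def matrix_matrix_mult_def vec_eq_iff poly_eval_sum poly_eval_mult)

lemma deriv_mat_mult:
  "deriv_mat \<xi> v (A ** B) = deriv_mat \<xi> v A ** eval_mat \<xi> B + eval_mat \<xi> A ** deriv_mat \<xi> v B"
  by (simp add: eval_mat_def deriv_mat_def matrix_matrix_mult_def vec_eq_iff poly_eval_sum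
      poly_eval_mult poly_eval_add pdiff_sum pdiff_mult sum.distrib)

lemma poly_eval_pdiff_trace: "poly_eval \<xi> (pdiff v (trace A)) = trace (deriv_mat \<xi> v A)"
  by (simp add: trace_def deriv_mat_def poly_eval_sum pdiff_sum)

text \<open>Linearity is phrased through values on matrix units, which is what differentiating a
  generic matrix produces; for 4 by 4 matrices it is a finite check of entries.\<close>

definition unit_linear :: "('a::field ^ 'n ^ 'n \<Rightarrow> 'a ^ 'n ^ 'n) \<Rightarrow> bool" where
  "unit_linear p \<longleftrightarrow> (\<forall>A i j. p A $ i $ j = (\<Sum>k\<in>UNIV. \<Sum>l\<in>UNIV. A $ k $ l * p (matrix_unit k l) $ i $ j))"

text \<open>The \<open>(k, l)\<close> entry of the derivative is the \<open>(i, j)\<close> entry of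
  \<open>p (matrix_unit l k)\<close>. The transposition in \<open>generic_matrix\<close> cancels the
  one in the trace pairing, so summing against \<open>K\<close> rebuilds \<open>p K\<close>.\<close>

lemma trace_deriv_generic_matrix:
  assumes "unit_linear p"
  shows "trace (deriv_mat \<xi> (i, j) (generic_matrix p) ** K) = p K $ i $ j"
proof -
  have "trace (deriv_mat \<xi> (i, j) (generic_matrix p) ** K)
      = (\<Sum>k\<in>UNIV. \<Sum>l\<in>UNIV. K $ l $ k * p (matrix_unit l k) $ i $ j)"
    by (simp add: trace_def matrix_matrix_mult_def deriv_mat_def generic_matrix_def pdiff_lin
        poly_eval_const mult.commute)
  also have "\<dots> = (\<Sum>l\<in>UNIV. \<Sum>k\<in>UNIV. K $ l $ k * p (matrix_unit l k) $ i $ j)"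
    by (rule sum.swap)
  also have "\<dots> = p K $ i $ j"
    using assms unfolding unit_linear_def by metis
  finally show ?thesis .
qed

text \<open>The three words with a single \<open>A\<close> are cyclic rotations of one another and
  so have equal traces.\<close>

lemma trace_word_sum_1_2:
  "trace (word_sum A B 1 2) = 3 * trace (A ** (B ** B))"
proof -
  have "trace (B ** (A ** B)) = trace (A ** (B ** B))"
    "trace (B ** (B ** A)) = trace (A ** (B ** B))"
    by (metis matrix_mul_assoc trace_mul_sym)+
  then show ?thesis
    by (simp add: eval_nat_numeral matrix_add_ldistrib trace_add)
qed

lemma trace_word_sum_1_3:
  "trace (word_sum A B 1 3) = 4 * trace (A ** (B ** (B ** B)))"
proof -
  have "trace (B ** (A ** (B ** B))) = trace (A ** (B ** (B ** B)))"
    "trace (B ** (B ** (A ** B))) = trace (A ** (B ** (B ** B)))"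
    "trace (B ** (B ** (B ** A))) = trace (A ** (B ** (B ** B)))"
    by (metis matrix_mul_assoc trace_mul_sym)+
  then show ?thesis
    by (simp add: eval_nat_numeral matrix_add_ldistrib trace_add)
qed

text \<open>The product rule gives one term per letter. Rotating the differentiated letter to the
  front brings each term into the form handled by \<open>trace_deriv_generic_matrix\<close>.\<close>

lemma gradient_trace_1_2:
  assumes "unit_linear p" "unit_linear q"
    and "eval_mat \<xi> (generic_matrix p) = X" "eval_mat \<xi> (generic_matrix q) = Y"
  shows "gradient \<xi> (trace (generic_matrix p ** (generic_matrix q ** generic_matrix q)))
    = p (Y ** Y) + q (Y ** X + X ** Y)"
proof -
  have "gradient \<xi> (trace (generic_matrix p ** (generic_matrix q ** generic_matrix q))) $ i $ j
    = (p (Y ** Y) + q (Y ** X + X ** Y)) $ i $ j" for i j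
  proof -
    let ?P = "deriv_mat \<xi> (i, j) (generic_matrix p)" and ?Q = "deriv_mat \<xi> (i, j) (generic_matrix q)"
    have "gradient \<xi> (trace (generic_matrix p ** (generic_matrix q ** generic_matrix q))) $ i $ j
      = trace (?P ** (Y ** Y)) + (trace (X ** (?Q ** Y)) + trace (X ** (Y ** ?Q)))"
      by (simp add: gradient_def poly_eval_pdiff_trace deriv_mat_mult eval_mat_mult assms(3,4)
          matrix_add_ldistrib trace_add)
    also have "trace (X ** (?Q ** Y)) = trace (?Q ** (Y ** X))"
      by (metis matrix_mul_assoc trace_mul_sym)
    also have "trace (X ** (Y ** ?Q)) = trace (?Q ** (X ** Y))"
      by (metis matrix_mul_assoc trace_mul_sym)
    also have "trace (?P ** (Y ** Y)) + (trace (?Q ** (Y ** X)) + trace (?Q ** (X ** Y)))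
      = trace (?P ** (Y ** Y)) + trace (?Q ** (Y ** X + X ** Y))"
      by (simp add: matrix_add_ldistrib trace_add)
    finally show ?thesis
      by (simp add: trace_deriv_generic_matrix assms(1,2))
  qed
  then show ?thesis by (simp add: vec_eq_iff)
qed

lemma gradient_trace_1_3:
  assumes "unit_linear p" "unit_linear q"
    and "eval_mat \<xi> (generic_matrix p) = X" "eval_mat \<xi> (generic_matrix q) = Y"
  shows "gradient \<xi> (trace (generic_matrix p ** (generic_matrix q ** (generic_matrix q ** generic_matrix q))))
    = p (Y ** (Y ** Y)) + q (Y ** (Y ** X) + (Y ** (X ** Y) + X ** (Y ** Y)))"
proof -
  have "gradient \<xi> (trace (generic_matrix p ** (generic_matrix q ** (generic_matrix q ** generic_matrix q)))) $ i $ j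
    = (p (Y ** (Y ** Y)) + q (Y ** (Y ** X) + (Y ** (X ** Y) + X ** (Y ** Y)))) $ i $ j" for i j
  proof -
    let ?P = "deriv_mat \<xi> (i, j) (generic_matrix p)" and ?Q = "deriv_mat \<xi> (i, j) (generic_matrix q)"
    have "gradient \<xi> (trace (generic_matrix p ** (generic_matrix q ** (generic_matrix q ** generic_matrix q)))) $ i $ j
      = trace (?P ** (Y ** (Y ** Y))) + (trace (X ** (?Q ** (Y ** Y)))
        + (trace (X ** (Y ** (?Q ** Y))) + trace (X ** (Y ** (Y ** ?Q)))))"
      by (simp add: gradient_def poly_eval_pdiff_trace deriv_mat_mult eval_mat_mult assms(3,4)
          matrix_add_ldistrib trace_add)
    also have "trace (X ** (?Q ** (Y ** Y))) = trace (?Q ** (Y ** (Y ** X)))"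
      by (metis matrix_mul_assoc trace_mul_sym)
    also have "trace (X ** (Y ** (?Q ** Y))) = trace (?Q ** (Y ** (X ** Y)))"
      by (metis matrix_mul_assoc trace_mul_sym)
    also have "trace (X ** (Y ** (Y ** ?Q))) = trace (?Q ** (X ** (Y ** Y)))"
      by (metis matrix_mul_assoc trace_mul_sym)
    also have "trace (?P ** (Y ** (Y ** Y))) + (trace (?Q ** (Y ** (Y ** X)))
        + (trace (?Q ** (Y ** (X ** Y))) + trace (?Q ** (X ** (Y ** Y)))))
      = trace (?P ** (Y ** (Y ** Y))) + trace (?Q ** (Y ** (Y ** X) + (Y ** (X ** Y) + X ** (Y ** Y))))"
      by (simp add: matrix_add_ldistrib trace_add)
    finally show ?thesis
      by (simp add: trace_deriv_generic_matrix assms(1,2))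
  qed
  then show ?thesis by (simp add: vec_eq_iff)
qed

section \<open>Two components that do not commute\<close>

text \<open>The orthogonal projection of gl_4 onto f for the trace form.\<close>

definition sl2_part :: "'a::field_char_0 ^ 4 ^ 4 \<Rightarrow> 'a ^ 4 ^ 4" where
  "sl2_part A = (\<chi> i j. if i \<in> {3, 4} \<and> j \<in> {3, 4}
     then A $ i $ j - (if i = j then (A $ 3 $ 3 + A $ 4 $ 4) / 2 else 0) else 0)"

text \<open>Starting from \<open>trace_free A\<close> makes the two parts add up to the projection
  onto sl_4, as \<open>trace_word_sum_in_Z_alg\<close> requires.\<close>

definition complement_part :: "'a::field_char_0 ^ 4 ^ 4 \<Rightarrow> 'a ^ 4 ^ 4" where
  "complement_part A = trace_free A - sl2_part A"

lemma sl2_part_in: "sl2_part A \<in> lower_right_sl2"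
  by (auto simp: sl2_part_def lower_right_sl2_def sl_def trace_def sum_4 field_simps)

text \<open>Pairing with f sees only the lower right block, where the complement part is a scalar
  matrix, and elements of f have traceless block.\<close>

lemma complement_part_in: "complement_part A \<in> trace_orthogonal sl lower_right_sl2"
proof -
  have "sl2_part A \<in> sl" using sl2_part_in[of A] by (simp add: lower_right_sl2_def)
  then have "complement_part A \<in> sl"
    using trace_free_in_sl[of A] by (simp add: complement_part_def sl_def trace_sub)
  moreover have "trace (complement_part A ** B) = 0" if B: "B \<in> lower_right_sl2" for B
  proof -
    have "B $ i $ j = 0" if "i \<notin> {3, 4} \<or> j \<notin> {3, 4}" for i j
      using B that unfolding lower_right_sl2_def by blast
    then have "B $ 1 $ i = 0" "B $ 2 $ i = 0" "B $ i $ 1 = 0" "B $ i $ 2 = 0" for i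
      by simp_all
    moreover have "B $ 4 $ 4 = - B $ 3 $ 3"
      using B by (simp add: lower_right_sl2_def add_eq_0_iff)
    ultimately show ?thesis
      by (simp add: trace_def matrix_matrix_mult_def sum_4 complement_part_def sl2_part_def
          trace_free_def mat_def field_simps)
  qed
  ultimately show ?thesis by (simp add: trace_orthogonal_def)
qed

lemma unit_linear_sl2_part: "unit_linear sl2_part"
  by (simp add: unit_linear_def forall_4 sum_4 sl2_part_def matrix_unit_def field_simps)

lemma unit_linear_complement_part: "unit_linear complement_part"
  by (simp add: unit_linear_def forall_4 sum_4 complement_part_def sl2_part_def matrix_unit_def
      trace_free_def trace_def mat_def field_simps)

text \<open>In block form \<open>((A, B), (C, D))\<close> the chosen point is \<open>A = E\<^sub>1\<^sub>2\<close>, \<open>B = 1\<close>, \<open>C = E\<^sub>1\<^sub>1\<close>, \<open>D = E\<^sub>2\<^sub>1\<close>.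
  The bracket of \<open>tr (D C B)\<close> and \<open>tr (D C A B)\<close> at a point with traceless \<open>D\<close> is
  \<open>tr ((C B D - D C B) C A B)\<close>, which is \<open>-1\<close> there.\<close>

definition f_point :: "'a::field_char_0 ^ 4 ^ 4" where
  "f_point = matrix_unit 4 3"

definition m_point :: "'a::field_char_0 ^ 4 ^ 4" where
  "m_point = matrix_unit 1 2 + matrix_unit 1 3 + matrix_unit 2 4 + matrix_unit 3 1"

text \<open>The indices are swapped because the \<open>(k, l)\<close> entry of a generic matrix is
  built from \<open>matrix_unit l k\<close>; the generic matrices thus evaluate to
  \<open>f_point\<close> and \<open>m_point\<close> themselves.\<close>

definition point :: "4 \<times> 4 \<Rightarrow> 'a::field_char_0" where
  "point = (\<lambda>(i, j). (f_point + m_point) $ j $ i)"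

lemma eval_sl2_part: "eval_mat point (generic_matrix sl2_part) = f_point"
  by (simp add: eval_mat_def generic_matrix_def poly_eval_lin vec_eq_iff forall_4 sum_4
      sl2_part_def matrix_unit_def point_def f_point_def m_point_def)

lemma eval_complement_part: "eval_mat point (generic_matrix complement_part) = m_point"
  by (simp add: eval_mat_def generic_matrix_def poly_eval_lin vec_eq_iff forall_4 sum_4
      complement_part_def trace_free_def trace_def mat_def
      sl2_part_def matrix_unit_def point_def f_point_def m_point_def)

text \<open>The left side is the gradient of tr(P Q^2) at the point. The lower right block of the
  square is E_33, whose traceless part gives the entries 1/2 and -1/2; the second argument is
  already traceless with zero lower right block.\<close>

lemma point_gradient_2:
  "sl2_part (m_point ** m_point) + complement_part (m_point ** f_point + f_point ** m_point)
    = (\<chi> i j. if (i, j) \<in> {(2, 3), (4, 1)} then 1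
        else if (i, j) = (3, 3) then 1 / 2 else if (i, j) = (4, 4) then - 1 / 2
        else (0 :: 'a::field_char_0))"
proof -
  have "m_point ** m_point = matrix_unit 1 1 + matrix_unit 1 4 + matrix_unit 3 2
      + (matrix_unit 3 3 :: 'a ^ 4 ^ 4)"
    by (simp add: vec_eq_iff forall_4 sum_4 m_point_def matrix_unit_def matrix_matrix_mult_def)
  moreover have "m_point ** f_point + f_point ** m_point
      = matrix_unit 2 3 + (matrix_unit 4 1 :: 'a ^ 4 ^ 4)"
    by (simp add: vec_eq_iff forall_4 sum_4 m_point_def f_point_def matrix_unit_def
        matrix_matrix_mult_def)
  ultimately show ?thesis
    by (simp add: vec_eq_iff forall_4 sum_4 complement_part_def trace_free_def trace_def
        mat_def sl2_part_def matrix_unit_def)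
qed

text \<open>The left side is the gradient of tr(P Q^3) at the point. The cube contributes only E_34,
  and E_43, which lies in f, is removed by \<open>complement_part\<close>.\<close>

lemma point_gradient_3:
  "sl2_part (m_point ** (m_point ** m_point)) + complement_part (m_point ** (m_point ** f_point)
      + (m_point ** (f_point ** m_point) + f_point ** (m_point ** m_point)))
    = matrix_unit 3 4 + matrix_unit 1 3 + matrix_unit 2 1 + (matrix_unit 4 2 :: 'a::field_char_0 ^ 4 ^ 4)"
proof -
  have mm: "m_point ** m_point = matrix_unit 1 1 + matrix_unit 1 4 + matrix_unit 3 2
      + (matrix_unit 3 3 :: 'a ^ 4 ^ 4)"
    by (simp add: vec_eq_iff forall_4 sum_4 m_point_def matrix_unit_def matrix_matrix_mult_def)
  have "m_point ** (m_point ** m_point) = matrix_unit 1 2 + matrix_unit 1 3 + matrix_unit 3 1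
      + (matrix_unit 3 4 :: 'a ^ 4 ^ 4)"
    unfolding mm
    by (simp add: vec_eq_iff forall_4 sum_4 m_point_def matrix_unit_def matrix_matrix_mult_def)
  moreover have "m_point ** (m_point ** f_point) + (m_point ** (f_point ** m_point)
      + f_point ** (m_point ** m_point))
      = matrix_unit 1 3 + matrix_unit 2 1 + matrix_unit 4 2 + (matrix_unit 4 3 :: 'a ^ 4 ^ 4)"
    unfolding matrix_mul_assoc
    by (simp add: vec_eq_iff forall_4 sum_4 m_point_def f_point_def matrix_unit_def
        matrix_matrix_mult_def)
  ultimately show ?thesis
    by (simp add: vec_eq_iff forall_4 sum_4 complement_part_def trace_free_def trace_def
        mat_def sl2_part_def matrix_unit_def)
qed

section \<open>Removal of numerical factors and the final contradiction\<close>

lemma scal_of_nat: "scal (of_nat n) p = of_nat n * p"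
  by (induction n) (simp_all add: gl_poly.scale_left_distrib distrib_right)

text \<open>In characteristic 0 a numeral factor can be undone by a scaling; this clears the 3 and 4
  counting cyclic rotations.\<close>

lemma numeral_mult_in_subalgebra_gen:
  assumes "numeral n * p \<in> subalgebra_gen X"
  shows "(p :: ('a::field_char_0, 'n) gl_poly) \<in> subalgebra_gen X"
proof -
  have "p = scal (1 / numeral n) (numeral n * p)"
    using scal_of_nat[of "numeral n" p, symmetric] by simp
  then show ?thesis using subalgebra_gen.scal[OF assms] by metis
qed

theorem mainTheorem3:
  fixes g f m :: "('a :: {alg_closed_field, field_char_0} ^ 4 ^ 4) set"
  assumes "g = sl"
    and "f = lower_right_sl2"
    and "m = trace_orthogonal g f"
  shows "\<not> poisson_commutative (Z_alg g f m)"
proof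
  assume comm: "poisson_commutative (Z_alg g f m)"
  define P Q :: "('a, 4) gl_poly ^ 4 ^ 4"
    where "P = generic_matrix sl2_part" and "Q = generic_matrix complement_part"
  have "trace (word_sum P Q i j) \<in> Z_alg g f m" for i j
    unfolding assms P_def Q_def
    by (intro trace_word_sum_in_Z_alg sl2_part_in complement_part_in)
      (simp add: complement_part_def)
  from this[of 1 2] this[of 1 3]
  have "trace (P ** (Q ** Q)) \<in> Z_alg g f m" "trace (P ** (Q ** (Q ** Q))) \<in> Z_alg g f m"
    unfolding trace_word_sum_1_2 trace_word_sum_1_3 Z_alg_def
    by (simp_all only: numeral_mult_in_subalgebra_gen)
  then have "poisson (trace (P ** (Q ** Q))) (trace (P ** (Q ** (Q ** Q)))) = 0"
    using comm by (simp add: poisson_commutative_def)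
  then have "poly_eval point (poisson (trace (P ** (Q ** Q))) (trace (P ** (Q ** (Q ** Q))))) = 0"
    by simp
  \<comment> \<open>The commutator of the two gradients is E_24 + E_34 - E_31 - (E_13 + E_42)/2.
    Evaluation takes the trace of its product with \<open>f_point + m_point\<close>, giving 1 - 1 -
    1/2 - 1/2.\<close>
  moreover have "poly_eval point (poisson (trace (P ** (Q ** Q))) (trace (P ** (Q ** (Q ** Q))))) = - 1"
    unfolding poly_eval_poisson P_def Q_def
      gradient_trace_1_2[OF unit_linear_sl2_part unit_linear_complement_part
        eval_sl2_part eval_complement_part]
      gradient_trace_1_3[OF unit_linear_sl2_part unit_linear_complement_part
        eval_sl2_part eval_complement_part]
      point_gradient_2 point_gradient_3
    by (simp add: poly_eval_lin sum_4 lie_bracket_def matrix_matrix_mult_def matrix_unit_def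
        point_def f_point_def m_point_def)
  ultimately show False by simp
qed

end
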